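(* Let $R$ be a commutative, associative, unital ring. If $M$ is a Noetherian $R$-module, then every direct sum of $\text{Red}$-$M$-injective $R$-modules is $\text{Red}$-$M$-injective.
   Context: All modules are unital right $R$-modules. An $R$-module $M$ is reduced if for all $r\in R$ and $m\in M$, $mr^{2}=0$ implies $mr=0$; a submodule is reduced if it is reduced as a module. $\text{Red}(M)$ denotes the sum of all reduced submodules of $M$. A module $M$ is semi-reduced if $\text{Red}(M)=M$; a submodule is semi-reduced if it is so as a module. For $R$-modules $M$ and $N$, $M$ is $\text{Red}$-$N$-injective if for every semi-reduced submodule $K$ of $N$, every $R$-homomorphism $f:K\rightarrow M$ extends to an $R$-homomorphism $N\rightarrow M$. *)

theory Defs
  imports "HOL-Algebra.Module" "HOL-Algebra.Product_Groups"
begin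

text \<open>
  The scalar ring is commutative, so right modules are rendered by the left modules of
  \<^theory>\<open>HOL-Algebra.Module\<close>; the product \<open>m r\<close> is written \<open>r \<odot> m\<close>.
  A submodule \<open>K\<close> of \<open>M\<close>, regarded as a module, is \<open>M\<lparr>carrier := K\<rparr>\<close>.
\<close>

definition module_homs ::
    "('a, 'r) ring_scheme \<Rightarrow> ('a, 'b, 'm) module_scheme \<Rightarrow> ('a, 'c, 'n) module_scheme \<Rightarrow> ('b \<Rightarrow> 'c) set"
  where "module_homs R M N =
    {f \<in> hom (add_monoid M) (add_monoid N).
       \<forall>r \<in> carrier R. \<forall>x \<in> carrier M. f (r \<odot>\<^bsub>M\<^esub> x) = r \<odot>\<^bsub>N\<^esub> f x}"

definition noetherian_module :: "('a, 'r) ring_scheme \<Rightarrow> ('a, 'b, 'm) module_scheme \<Rightarrow> bool"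
  where "noetherian_module R M \<longleftrightarrow>
    module R M \<and>
    (\<forall>C :: nat \<Rightarrow> 'b set.
       (\<forall>n. submodule (C n) R M) \<and> (\<forall>n. C n \<subseteq> C (Suc n)) \<longrightarrow> (\<exists>n. \<forall>k \<ge> n. C k = C n))"

definition reduced_module :: "('a, 'r) ring_scheme \<Rightarrow> ('a, 'b, 'm) module_scheme \<Rightarrow> bool"
  where "reduced_module R M \<longleftrightarrow>
    (\<forall>r \<in> carrier R. \<forall>m \<in> carrier M.
       (r [^]\<^bsub>R\<^esub> (2::nat)) \<odot>\<^bsub>M\<^esub> m = \<zero>\<^bsub>M\<^esub> \<longrightarrow> r \<odot>\<^bsub>M\<^esub> m = \<zero>\<^bsub>M\<^esub>)"

text \<open>The sum of a (possibly infinite) set of submodules: all finite sums of their elements.\<close>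

definition sum_submodules :: "('a, 'b, 'm) module_scheme \<Rightarrow> 'b set set \<Rightarrow> 'b set"
  where "sum_submodules M \<S> =
    {finsum M x F | F x. finite F \<and> F \<subseteq> \<S> \<and> (\<forall>K \<in> F. x K \<in> K)}"

definition Red :: "('a, 'r) ring_scheme \<Rightarrow> ('a, 'b, 'm) module_scheme \<Rightarrow> 'b set"
  where "Red R M =
    sum_submodules M {K. submodule K R M \<and> reduced_module R (M\<lparr>carrier := K\<rparr>)}"

definition semi_reduced :: "('a, 'r) ring_scheme \<Rightarrow> ('a, 'b, 'm) module_scheme \<Rightarrow> bool"
  where "semi_reduced R M \<longleftrightarrow> Red R M = carrier M"

text \<open>\<open>Red_injective R N M\<close>: the module \<open>M\<close> is Red-\<open>N\<close>-injective.\<close>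

definition Red_injective ::
    "('a, 'r) ring_scheme \<Rightarrow> ('a, 'b, 'n) module_scheme \<Rightarrow> ('a, 'c, 'm) module_scheme \<Rightarrow> bool"
  where "Red_injective R N M \<longleftrightarrow>
    (\<forall>K. submodule K R N \<and> semi_reduced R (N\<lparr>carrier := K\<rparr>) \<longrightarrow>
       (\<forall>f \<in> module_homs R (N\<lparr>carrier := K\<rparr>) M.
          \<exists>g \<in> module_homs R N M. \<forall>x \<in> K. g x = f x))"

text \<open>
  The direct sum of a family of modules over an arbitrary index set. The ring fields
  \<open>mult\<close> and \<open>one\<close> of the record are irrelevant for a module.
\<close>

definition direct_sum_module ::
    "'i set \<Rightarrow> ('i \<Rightarrow> ('a, 'c, 'm) module_scheme) \<Rightarrow> ('a, 'i \<Rightarrow> 'c) module"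
  where "direct_sum_module I N =
    \<lparr>carrier = {x \<in> \<Pi>\<^sub>E i\<in>I. carrier (N i). finite {i \<in> I. x i \<noteq> \<zero>\<^bsub>N i\<^esub>}},
     mult = undefined,
     one = undefined,
     zero = (\<lambda>i\<in>I. \<zero>\<^bsub>N i\<^esub>),
     add = (\<lambda>x y. \<lambda>i\<in>I. x i \<oplus>\<^bsub>N i\<^esub> y i),
     smult = (\<lambda>r x. \<lambda>i\<in>I. r \<odot>\<^bsub>N i\<^esub> x i)\<rparr>"

lemma module_direct_sum_module:
  assumes R: "cring R" and N: "\<And>i. i \<in> I \<Longrightarrow> module R (N i)"
  shows "module R (direct_sum_module I N)"
proof -
  let ?D = "direct_sum_module I N"
  have ab: "abelian_group (N i)" if "i \<in> I" for i
    using N[OF that] by (simp add: module_def)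
  have g: "group (add_monoid (N i))" if "i \<in> I" for i
    using ab[OF that] by (simp add: abelian_group_def abelian_group_axioms_def comm_group_def)
  let ?S = "sum_group I (\<lambda>i. add_monoid (N i))"
  have "carrier ?S = carrier ?D" "mult ?S = add ?D" "one ?S = zero ?D"
    using carrier_sum_group[of I "\<lambda>i. add_monoid (N i)"] g
    by (simp_all add: direct_sum_module_def sum_group_def)
  moreover have "group ?S"
    by (rule sum_group) (rule g)
  ultimately have grp: "group (add_monoid ?D)"
    by (simp add: group_def monoid_def group_axioms_def Units_def)
  have comm: "x \<oplus>\<^bsub>?D\<^esub> y = y \<oplus>\<^bsub>?D\<^esub> x" if "x \<in> carrier ?D" "y \<in> carrier ?D" for x y
    using that ab
    by (auto simp: direct_sum_module_def fun_eq_iff restrict_def PiE_iff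
        intro!: abelian_monoid.a_comm abelian_group.axioms(1))
  have cg: "comm_group (add_monoid ?D)"
    by (rule group.group_comm_groupI[OF grp]) (use comm in simp)
  show ?thesis
  proof (rule moduleI[OF R])
    show "abelian_group ?D"
      using cg by (simp add: abelian_group_def abelian_group_axioms_def abelian_monoid_def comm_group_def)
  next
    fix a x assume a: "a \<in> carrier R" and x: "x \<in> carrier ?D"
    have "a \<odot>\<^bsub>N i\<^esub> \<zero>\<^bsub>N i\<^esub> = \<zero>\<^bsub>N i\<^esub>" if "i \<in> I" for i
      using module.smult_r_null[OF N[OF that] a] .
    then have "{i \<in> I. a \<odot>\<^bsub>N i\<^esub> x i \<noteq> \<zero>\<^bsub>N i\<^esub>} \<subseteq> {i \<in> I. x i \<noteq> \<zero>\<^bsub>N i\<^esub>}"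
      by auto
    moreover have "finite {i \<in> I. x i \<noteq> \<zero>\<^bsub>N i\<^esub>}"
      using x by (simp add: direct_sum_module_def)
    ultimately have "finite {i \<in> I. a \<odot>\<^bsub>N i\<^esub> x i \<noteq> \<zero>\<^bsub>N i\<^esub>}"
      by (rule finite_subset)
    then show "a \<odot>\<^bsub>?D\<^esub> x \<in> carrier ?D"
      using a x by (auto simp: direct_sum_module_def PiE_iff module.smult_closed[OF N] cong: conj_cong)
  qed (auto simp: direct_sum_module_def PiE_iff fun_eq_iff restrict_def extensional_def
        module.smult_l_distr[OF N] module.smult_r_distr[OF N] module.smult_assoc1[OF N] module.smult_one[OF N])
qed

end

theory Submission
  imports Defs
begin

text \<open>
  If a homomorphism \<open>f\<close> from a submodule \<open>K\<close> of \<open>M\<close> to the direct sum had infinitely many nonzero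
  components, say at distinct indices \<open>s 0, s 1, \<dots>\<close>, then the submodules
  \<open>{x \<in> K. f x (s j) = 0 for all j \<ge> n}\<close> would increase with \<open>n\<close>, and their union would be \<open>K\<close>,
  because every \<open>f x\<close> has finite support. The ascending chain condition makes one of them equal
  to \<open>K\<close>, so that almost all components at the \<open>s j\<close> vanish after all. Hence extending the finitely
  many nonzero components of \<open>f\<close> separately, and the others by zero, again gives values in the
  direct sum.
\<close>

lemma module_homsD:
  assumes "f \<in> module_homs R M N"
  shows "\<And>x. x \<in> carrier M \<Longrightarrow> f x \<in> carrier N"
    and "\<And>x y. x \<in> carrier M \<Longrightarrow> y \<in> carrier M \<Longrightarrow> f (x \<oplus>\<^bsub>M\<^esub> y) = f x \<oplus>\<^bsub>N\<^esub> f y"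
    and "\<And>r x. r \<in> carrier R \<Longrightarrow> x \<in> carrier M \<Longrightarrow> f (r \<odot>\<^bsub>M\<^esub> x) = r \<odot>\<^bsub>N\<^esub> f x"
  using assms by (auto simp: module_homs_def hom_def)

lemma module_homsI:
  assumes "\<And>x. x \<in> carrier M \<Longrightarrow> f x \<in> carrier N"
    and "\<And>x y. x \<in> carrier M \<Longrightarrow> y \<in> carrier M \<Longrightarrow> f (x \<oplus>\<^bsub>M\<^esub> y) = f x \<oplus>\<^bsub>N\<^esub> f y"
    and "\<And>r x. r \<in> carrier R \<Longrightarrow> x \<in> carrier M \<Longrightarrow> f (r \<odot>\<^bsub>M\<^esub> x) = r \<odot>\<^bsub>N\<^esub> f x"
  shows "f \<in> module_homs R M N"
  using assms by (auto simp: module_homs_def hom_def)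

lemma zero_in_module_homs:
  assumes "module R N"
  shows "(\<lambda>x. \<zero>\<^bsub>N\<^esub>) \<in> module_homs R M N"
proof -
  interpret N: module R N by fact
  show ?thesis by (rule module_homsI) auto
qed

lemma direct_sum_component_hom:
  assumes "f \<in> module_homs R M (direct_sum_module I N)" and "i \<in> I"
  shows "(\<lambda>x. f x i) \<in> module_homs R M (N i)"
  using module_homsD[OF assms(1)] assms(2)
  by (intro module_homsI) (auto simp: direct_sum_module_def)

text \<open>Finiteness of \<open>J\<close>, chosen before \<open>x\<close>, is what places the
  assembled values in the direct sum and not merely in the product: every support is contained in
  \<open>J\<close>.\<close>

lemma direct_sum_hom_of_components:
  assumes N: "\<And>i. i \<in> I \<Longrightarrow> module R (N i)"
    and g: "\<And>i. i \<in> I \<Longrightarrow> g i \<in> module_homs R M (N i)"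
    and J: "finite J"
    and vanish: "\<And>i x. i \<in> I - J \<Longrightarrow> x \<in> carrier M \<Longrightarrow> g i x = \<zero>\<^bsub>N i\<^esub>"
  shows "(\<lambda>x. \<lambda>i\<in>I. g i x) \<in> module_homs R M (direct_sum_module I N)"
proof (rule module_homsI)
  fix x assume x: "x \<in> carrier M"
  have "{i \<in> I. g i x \<noteq> \<zero>\<^bsub>N i\<^esub>} \<subseteq> J" using vanish x by auto
  then have "finite {i \<in> I. g i x \<noteq> \<zero>\<^bsub>N i\<^esub>}" using J finite_subset by blast
  moreover have "{i \<in> I. (\<lambda>i\<in>I. g i x) i \<noteq> \<zero>\<^bsub>N i\<^esub>} = {i \<in> I. g i x \<noteq> \<zero>\<^bsub>N i\<^esub>}" by auto
  ultimately show "(\<lambda>i\<in>I. g i x) \<in> carrier (direct_sum_module I N)"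
    using module_homsD(1)[OF g x] by (simp add: direct_sum_module_def)
qed (use module_homsD(2,3)[OF g] in \<open>auto simp: direct_sum_module_def fun_eq_iff\<close>)

text \<open>Supplies the members of the ascending chain. The index set \<open>A\<close> is arbitrary
  because each of them imposes conditions on infinitely many components at once.\<close>

lemma submodule_common_kernel:
  assumes M: "module R M" and K: "submodule K R M"
    and N: "\<And>i. i \<in> A \<Longrightarrow> module R (N i)"
    and h: "\<And>i. i \<in> A \<Longrightarrow> h i \<in> module_homs R (M\<lparr>carrier := K\<rparr>) (N i)"
  shows "submodule {x \<in> K. \<forall>i\<in>A. h i x = \<zero>\<^bsub>N i\<^esub>} R M"
proof -
  interpret M: module R M by fact
  have sub: "K \<subseteq> carrier M" and closed: "\<And>x y. x \<in> K \<Longrightarrow> y \<in> K \<Longrightarrow> x \<oplus>\<^bsub>M\<^esub> y \<in> K"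
    "\<And>r x. r \<in> carrier R \<Longrightarrow> x \<in> K \<Longrightarrow> r \<odot>\<^bsub>M\<^esub> x \<in> K" and zero: "\<zero>\<^bsub>M\<^esub> \<in> K"
    using M.submoduleE[OF K] submodule.axioms(1)[OF K] subgroup.one_closed by fastforce+
  have add: "h i (x \<oplus>\<^bsub>M\<^esub> y) = h i x \<oplus>\<^bsub>N i\<^esub> h i y"
    if "i \<in> A" "x \<in> K" "y \<in> K" for i x y
    using module_homsD(2)[OF h] that by simp
  have scale: "h i (r \<odot>\<^bsub>M\<^esub> x) = r \<odot>\<^bsub>N i\<^esub> h i x"
    if "i \<in> A" "r \<in> carrier R" "x \<in> K" for i r x
    using module_homsD(3)[OF h] that by simp
  have scale_zero: "r \<odot>\<^bsub>N i\<^esub> \<zero>\<^bsub>N i\<^esub> = \<zero>\<^bsub>N i\<^esub>" if "i \<in> A" "r \<in> carrier R" for i r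
    using module.smult_r_null[OF N] that .
  have add_zero: "\<zero>\<^bsub>N i\<^esub> \<oplus>\<^bsub>N i\<^esub> \<zero>\<^bsub>N i\<^esub> = \<zero>\<^bsub>N i\<^esub>" if "i \<in> A" for i
  proof -
    interpret module R "N i" by (rule N[OF that])
    show ?thesis by simp
  qed
  \<comment> \<open>Membership in \<open>module_homs\<close> does not list preservation of zero;
    writing zero as the scalar zero times zero reduces it to compatibility with scalars.\<close>
  have at_zero: "h i \<zero>\<^bsub>M\<^esub> = \<zero>\<^bsub>N i\<^esub>" if i: "i \<in> A" for i
  proof -
    interpret Ni: module R "N i" by (rule N[OF i])
    have "h i \<zero>\<^bsub>M\<^esub> = h i (\<zero>\<^bsub>R\<^esub> \<odot>\<^bsub>M\<^esub> \<zero>\<^bsub>M\<^esub>)" by simp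
    also have "\<dots> = \<zero>\<^bsub>R\<^esub> \<odot>\<^bsub>N i\<^esub> h i \<zero>\<^bsub>M\<^esub>" using scale[OF i _ zero] by blast
    also have "\<dots> = \<zero>\<^bsub>N i\<^esub>" using module_homsD(1)[OF h[OF i], of "\<zero>\<^bsub>M\<^esub>"] zero by simp
    finally show ?thesis .
  qed
  \<comment> \<open>Negation is scaling by minus one, so closure under negation becomes an instance
    of \<open>smult_H\<close>.\<close>
  have minus: "\<ominus>\<^bsub>M\<^esub> x = (\<ominus>\<^bsub>R\<^esub> \<one>\<^bsub>R\<^esub>) \<odot>\<^bsub>M\<^esub> x" if "x \<in> K" for x
    using M.smult_l_minus[of "\<one>\<^bsub>R\<^esub>" x] that sub by auto
  let ?H = "{x \<in> K. \<forall>i\<in>A. h i x = \<zero>\<^bsub>N i\<^esub>}"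
  have smult_H: "r \<odot>\<^bsub>M\<^esub> x \<in> ?H" if "r \<in> carrier R" "x \<in> ?H" for r x
    using that by (simp add: closed scale scale_zero)
  show ?thesis
  proof (rule M.submoduleI)
    show "?H \<subseteq> carrier M" using sub by blast
    show "\<zero>\<^bsub>M\<^esub> \<in> ?H" using zero at_zero by simp
    show "\<ominus>\<^bsub>M\<^esub> x \<in> ?H" if x: "x \<in> ?H" for x
    proof -
      have "\<ominus>\<^bsub>R\<^esub> \<one>\<^bsub>R\<^esub> \<in> carrier R" by simp
      moreover have "x \<in> K" using x by simp
      ultimately show ?thesis using smult_H[OF _ x] unfolding minus[OF \<open>x \<in> K\<close>] by blast
    qed
    show "x \<oplus>\<^bsub>M\<^esub> y \<in> ?H" if "x \<in> ?H" "y \<in> ?H" for x y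
      using that by (simp add: closed add add_zero)
  qed (rule smult_H)
qed

lemma noetherian_ascending_union:
  assumes "noetherian_module R M"
    and "\<And>n. submodule (C n) R M" and "\<And>n. C n \<subseteq> C (Suc n)"
  obtains n where "(\<Union>k. C k) = C n"
proof -
  have "(\<forall>n. submodule (C n) R M) \<and> (\<forall>n. C n \<subseteq> C (Suc n)) \<longrightarrow> (\<exists>n. \<forall>k \<ge> n. C k = C n)"
    using assms(1) unfolding noetherian_module_def by (elim conjE allE)
  then obtain n where n: "\<And>k. k \<ge> n \<Longrightarrow> C k = C n"
    using assms(2,3) by auto
  \<comment> \<open>The index \<open>max n k\<close> lies above both: monotonicity gives the
    inclusion of \<open>C k\<close>, stabilisation the equality with \<open>C n\<close>.\<close>
  have "C k \<subseteq> C n" for k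
    using lift_Suc_mono_le[of C k "max n k", OF assms(3)] n[of "max n k"] by simp
  then show thesis by (intro that) blast
qed

text \<open>Each single \<open>f x\<close> has finite support by definition of the direct sum; the
  chain condition makes the finite set of indices uniform in \<open>x\<close>.\<close>

lemma noetherian_finitely_many_components:
  assumes M: "noetherian_module R M" and K: "submodule K R M"
    and N: "\<And>i. i \<in> I \<Longrightarrow> module R (N i)"
    and f: "f \<in> module_homs R (M\<lparr>carrier := K\<rparr>) (direct_sum_module I N)"
  shows "finite {i \<in> I. \<exists>x\<in>K. f x i \<noteq> \<zero>\<^bsub>N i\<^esub>}" (is "finite ?J")
proof (rule ccontr)
  assume "infinite ?J"
  then obtain s :: "nat \<Rightarrow> _" where inj: "inj s" and s: "range s \<subseteq> ?J"
    using infinite_countable_subset by blast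
  define C where "C n = {x \<in> K. \<forall>i\<in>s ` {n..}. f x i = \<zero>\<^bsub>N i\<^esub>}" for n
  have sI: "s j \<in> I" for j
    using s by blast
  have "submodule (C n) R M" for n
    unfolding C_def
  proof (rule submodule_common_kernel[OF _ K])
    show "module R M" using M by (simp add: noetherian_module_def)
    fix i assume "i \<in> s ` {n..}"
    then have "i \<in> I" using sI by blast
    then show "module R (N i)" and "(\<lambda>x. f x i) \<in> module_homs R (M\<lparr>carrier := K\<rparr>) (N i)"
      using N direct_sum_component_hom[OF f] by blast+
  qed
  moreover have "C n \<subseteq> C (Suc n)" for n
    by (auto simp: C_def)
  ultimately obtain n where n: "(\<Union>k. C k) = C n"
    by (rule noetherian_ascending_union[OF M])
  have "K \<subseteq> (\<Union>k. C k)"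
  proof
    fix x assume x: "x \<in> K"
    have "finite {i \<in> I. f x i \<noteq> \<zero>\<^bsub>N i\<^esub>}"
      using module_homsD(1)[OF f, of x] x by (simp add: direct_sum_module_def)
    \<comment> \<open>Injectivity of \<open>s\<close> turns the finite support of \<open>f x\<close>
      into a finite set of positions. Any strict upper bound \<open>k\<close> of these positions
      puts \<open>x\<close> into \<open>C k\<close>.\<close>
    then have "finite (s -` {i \<in> I. f x i \<noteq> \<zero>\<^bsub>N i\<^esub>})"
      using inj by (rule finite_vimageI)
    then obtain k where "s -` {i \<in> I. f x i \<noteq> \<zero>\<^bsub>N i\<^esub>} \<subseteq> {..<k}"
      using finite_nat_bounded by blast
    then have "f x (s j) = \<zero>\<^bsub>N (s j)\<^esub>" if "j \<ge> k" for j
      using sI[of j] that by fastforce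
    then have "x \<in> C k" using x by (simp add: C_def)
    then show "x \<in> (\<Union>k. C k)" by blast
  qed
  then have "K \<subseteq> C n" unfolding n .
  \<comment> \<open>The tail \<open>{n..}\<close> contains \<open>n\<close> itself, so the component
    at \<open>s n\<close> vanishes on all of \<open>K\<close>, although \<open>s n\<close> was taken
    from the indices of nonzero components.\<close>
  then have "f x (s n) = \<zero>\<^bsub>N (s n)\<^esub>" if "x \<in> K" for x
    using that by (fastforce simp: C_def)
  moreover have "s n \<in> ?J" using s by blast
  ultimately show False by blast
qed

lemma Red_injectiveD:
  assumes "Red_injective R M N" and "submodule K R M" and "semi_reduced R (M\<lparr>carrier := K\<rparr>)"
    and "f \<in> module_homs R (M\<lparr>carrier := K\<rparr>) N"
  shows "\<exists>g\<in>module_homs R M N. \<forall>x\<in>K. g x = f x"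
  using assms(1)[unfolded Red_injective_def, rule_format, OF conjI[OF assms(2,3)] assms(4)]
  by simp

theorem proposition4:
  fixes R :: "('a, 'r) ring_scheme"
    and M :: "('a, 'b, 'm) module_scheme"
    and I :: "'i set"
    and N :: "'i \<Rightarrow> ('a, 'c, 'n) module_scheme"
  assumes "cring R"
    and "noetherian_module R M"
    and "\<And>i. i \<in> I \<Longrightarrow> module R (N i)"
    and "\<And>i. i \<in> I \<Longrightarrow> Red_injective R M (N i)"
  shows "Red_injective R M (direct_sum_module I N)"
  unfolding Red_injective_def
proof (intro allI impI ballI, elim conjE)
  fix K f
  assume K: "submodule K R M" and semi: "semi_reduced R (M\<lparr>carrier := K\<rparr>)"
    and f: "f \<in> module_homs R (M\<lparr>carrier := K\<rparr>) (direct_sum_module I N)"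
  define J where "J = {i \<in> I. \<exists>x\<in>K. f x i \<noteq> \<zero>\<^bsub>N i\<^esub>}"
  have J: "finite J"
    unfolding J_def by (rule noetherian_finitely_many_components[OF assms(2) K assms(3) f])
  \<comment> \<open>The last conjunct matters: a zero component on \<open>K\<close> may also have
    nonzero extensions to \<open>M\<close>, and infinitely many of these could leave the direct sum.
    Outside \<open>J\<close> the zero extension is therefore prescribed.\<close>
  have "\<exists>g. g \<in> module_homs R M (N i) \<and> (\<forall>x\<in>K. g x = f x i) \<and>
      (i \<notin> J \<longrightarrow> g = (\<lambda>x. \<zero>\<^bsub>N i\<^esub>))" if i: "i \<in> I" for i
  proof (cases "i \<in> J")
    case True
    obtain g where "g \<in> module_homs R M (N i)" "\<forall>x\<in>K. g x = f x i"
      using Red_injectiveD[OF assms(4)[OF i] K semi direct_sum_component_hom[OF f i]]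
      by (rule bexE)
    with True show ?thesis by (intro exI[of _ g]) simp
  next
    case False
    then have "\<forall>x\<in>K. \<zero>\<^bsub>N i\<^esub> = f x i" using i by (simp add: J_def)
    then show ?thesis using zero_in_module_homs[OF assms(3)[OF i]] False
      by (intro exI[of _ "\<lambda>x. \<zero>\<^bsub>N i\<^esub>"]) simp
  qed
  then have "\<forall>i\<in>I. \<exists>g. g \<in> module_homs R M (N i) \<and> (\<forall>x\<in>K. g x = f x i) \<and>
      (i \<notin> J \<longrightarrow> g = (\<lambda>x. \<zero>\<^bsub>N i\<^esub>))"
    by (rule ballI)
  from bchoice[OF this] obtain g where
    g_all: "\<forall>i\<in>I. g i \<in> module_homs R M (N i) \<and> (\<forall>x\<in>K. g i x = f x i) \<and>
      (i \<notin> J \<longrightarrow> g i = (\<lambda>x. \<zero>\<^bsub>N i\<^esub>))" ..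
  have g: "g i \<in> module_homs R M (N i)" if "i \<in> I" for i
    using g_all that by simp
  have ext: "g i x = f x i" if "i \<in> I" "x \<in> K" for i x
    using g_all that by simp
  have vanish: "g i x = \<zero>\<^bsub>N i\<^esub>" if "i \<in> I - J" for i x
    using g_all that by simp
  have "(\<lambda>x. \<lambda>i\<in>I. g i x) \<in> module_homs R M (direct_sum_module I N)"
    by (rule direct_sum_hom_of_components[OF assms(3) g J vanish])
  \<comment> \<open>Elements of the direct sum are extensional on \<open>I\<close>, so agreement of
    all components gives equality of functions.\<close>
  moreover have "(\<lambda>i\<in>I. g i x) = f x" if x: "x \<in> K" for x
  proof (rule extensionalityI)
    show "f x \<in> extensional I"
      using module_homsD(1)[OF f, of x] x by (simp add: direct_sum_module_def PiE_iff)
  qed (simp_all add: ext x)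
  ultimately show "\<exists>g\<in>module_homs R M (direct_sum_module I N). \<forall>x\<in>K. g x = f x"
    by (intro bexI ballI)
qed

end
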